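(* For integers $\nu\ge1$ and $n>\nu(2\nu+3)$, \[ (-1)^\nu\left(\sum_{\tau=0}^{\nu}(-1)^\tau p\big(2n-\tau(2\tau+1)\big)-\sum_{\tau=0}^{\nu-1}(-1)^\tau p\big(2n-(\tau+1)(2\tau+1)\big)\right)=(-1)^\nu p_o(n)+p(3,4,\nu;2n)+p(1,4,\nu;2n) \] and \[ (-1)^\nu\left(\sum_{\tau=0}^{\nu}(-1)^\tau p\big(2n+1-\tau(2\tau+1)\big)-\sum_{\tau=0}^{\nu-1}(-1)^\tau p\big(2n+1-(\tau+1)(2\tau+1)\big)\right)=p(3,4,\nu;2n+1)+p(1,4,\nu;2n+1). \]
   Context: $p(n)$ is the number of partitions of $n$ and $p_o(n)$ the number of partitions of $n$ into odd parts. Definition of $M(a,m,\nu;n)$ (integers $\nu\ge0$, $1\le a<m$, $n\ge0$): for a partition $\lambda_1\ge\dots\ge\lambda_k$ of $n$ into parts $\equiv a\pmod m$, put $\ell_i=(\lambda_i-a)/m+1$ (number of boxes of the row of $\lambda_i$ in the $m$-modular Young diagram), and let $t$ be the largest integer $0\le t\le k$ with $\ell_t\ge t+\nu+2$ (height of the $(\nu+2)$-Durfee rectangle, of width $t+\nu+2$). $M(a,m,\nu;n)$ counts partitions of $n$ into parts $\equiv a\pmod m$ in which each of $a,a+m,\dots,a+m\nu$ occurs at least once and $\ell_i<t+\nu+2$ for all $i>t$. Definition: $p(a,m,\nu;n)$ is the number of partitions of $n$ such that, if $\beta$ is the sum of the parts $\not\equiv a\pmod m$, the parts $\equiv a\pmod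 m$ form a partition counted by $M(a,m,\nu;n-\beta)$. *)

theory Defs
  imports "HOL-Library.Multiset" "HOL-Number_Theory.Cong"
begin

definition partitions_of :: "nat \<Rightarrow> nat multiset set" where
  "partitions_of n = {P. (\<forall>x\<in>#P. 0 < x) \<and> sum_mset P = n}"

lemma finite_partitions_of: "finite (partitions_of n)"
proof (rule finite_subset)
  show "finite (mset ` {xs. set xs \<subseteq> {..n} \<and> length xs \<le> n})"
    by (intro finite_imageI finite_lists_length_le) simp
  show "partitions_of n \<subseteq> mset ` {xs. set xs \<subseteq> {..n} \<and> length xs \<le> n}"
  proof
    fix P assume P: "P \<in> partitions_of n"
    obtain xs where xs: "P = mset xs" using ex_mset by metis
    have pos: "\<forall>x\<in>set xs. 0 < x" and s: "sum_list xs = n"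
      using P by (auto simp: partitions_of_def xs sum_mset_sum_list)
    have "length xs \<le> sum_list xs" using pos by (induction xs) auto
    moreover have "set xs \<subseteq> {..n}" using member_le_sum_list s by fastforce
    ultimately show "P \<in> mset ` {xs. set xs \<subseteq> {..n} \<and> length xs \<le> n}"
      using xs s by blast
  qed
qed

definition num_partitions :: "nat \<Rightarrow> nat" where
  "num_partitions n = card (partitions_of n)"

definition num_odd_partitions :: "nat \<Rightarrow> nat" where
  "num_odd_partitions n = card {P \<in> partitions_of n. \<forall>x\<in>#P. odd x}"

text \<open>
  The rows \<open>\<ell>\<^sub>1 \<ge> \<ell>\<^sub>2 \<ge> \<dots>\<close> of the \<open>m\<close>-modular Young diagram.
  This is meant for parts \<open>x \<equiv> a (mod m)\<close> with \<open>a < m\<close>, where \<open>a \<le> x\<close> and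
  subtraction and division are exact.
\<close>

definition modular_rows :: "nat \<Rightarrow> nat \<Rightarrow> nat multiset \<Rightarrow> nat list" where
  "modular_rows a m P = map (\<lambda>x. (x - a) div m + 1) (rev (sorted_list_of_multiset P))"

text \<open>
  Lists are indexed from \<open>0\<close>, so \<open>\<ell>\<^sub>i\<close> is \<open>ls ! (i - 1)\<close>. The condition on \<open>\<ell>\<^sub>t\<close> is
  void for \<open>t = 0\<close>, which makes the height \<open>0\<close> when no row is long enough.
\<close>

definition durfee_height :: "nat \<Rightarrow> nat list \<Rightarrow> nat" where
  "durfee_height d ls = Max {t. t \<le> length ls \<and> (0 < t \<longrightarrow> t + d \<le> ls ! (t - 1))}"

definition M_partitions :: "nat \<Rightarrow> nat \<Rightarrow> nat \<Rightarrow> nat \<Rightarrow> nat multiset set" where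
  "M_partitions a m \<nu> n =
     {P \<in> partitions_of n.
        (\<forall>x\<in>#P. [x = a] (mod m)) \<and>
        (\<forall>j\<le>\<nu>. a + m * j \<in># P) \<and>
        (let ls = modular_rows a m P; t = durfee_height (\<nu> + 2) ls
         in \<forall>i. t < i \<and> i \<le> length ls \<longrightarrow> ls ! (i - 1) < t + \<nu> + 2)}"

definition p_amnu :: "nat \<Rightarrow> nat \<Rightarrow> nat \<Rightarrow> nat \<Rightarrow> nat" where
  "p_amnu a m \<nu> n =
     card {P \<in> partitions_of n.
        let \<beta> = sum_mset (filter_mset (\<lambda>x. \<not> [x = a] (mod m)) P)
        in filter_mset (\<lambda>x. [x = a] (mod m)) P \<in> M_partitions a m \<nu> (n - \<beta>)}"

end

theory Submission
  imports Defs "HOL-Computational_Algebra.Formal_Power_Series"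
begin

text \<open>
  Let \<open>A\<^sub>N\<close> be the set of partitions of \<open>n\<close> containing each of \<open>a, a + m, \<dots>, a + m (N - 1)\<close>, and
  \<open>D\<^sub>N\<close> the set of those in \<open>A\<^sub>N\<close> for which some \<open>t\<close> satisfies: exactly \<open>t\<close> parts congruent to \<open>a\<close>
  have at least \<open>t + N + 1\<close> boxes. Then \<open>|D\<^bsub>\<nu>+1\<^esub>| = p(a,m,\<nu>;n)\<close>, and a bijection between
  \<open>A\<^sub>N - D\<^sub>N\<close> and \<open>D\<^bsub>N+1\<^esub>\<close> gives \<open>|D\<^sub>N| + |D\<^bsub>N+1\<^esub>| = |A\<^sub>N|\<close>. Removing one copy of each prescribed
  part, \<open>|A\<^sub>N|\<close> is a value of the partition function, so the two alternating sums telescope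
  (\<open>a = 3\<close> and \<open>a = 1\<close>, \<open>m = 4\<close>). What is left is independent of \<open>\<nu>\<close>; letting \<open>\<nu>\<close> grow it is the
  coefficient of Jacobi's theta series divided by the Euler product, that is, the number of
  partitions into parts congruent to 2 modulo 4.
\<close>

section \<open>The bijection\<close>

text \<open>The part \<open>a + m * s\<close> is a row of \<open>s + 1\<close> boxes in the modular diagram.\<close>

definition class_tail :: "nat \<Rightarrow> nat \<Rightarrow> nat \<Rightarrow> nat multiset \<Rightarrow> nat multiset" where
  "class_tail a m s P = filter_mset (\<lambda>x. [x = a] (mod m) \<and> a + m * s \<le> x) P"

definition staircase_partitions :: "nat \<Rightarrow> nat \<Rightarrow> nat \<Rightarrow> nat \<Rightarrow> nat multiset set" where
  "staircase_partitions a m N n = {P \<in> partitions_of n. \<forall>j<N. a + m * j \<in># P}"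

definition durfee_partitions :: "nat \<Rightarrow> nat \<Rightarrow> nat \<Rightarrow> nat \<Rightarrow> nat multiset set" where
  "durfee_partitions a m N n =
     {P \<in> staircase_partitions a m N n. \<exists>t. size (class_tail a m (t + N) P) = t}"

text \<open>
  A pair \<open>(U, L)\<close> with \<open>t = size U\<close> encodes two partitions at once. With the extra part
  \<open>a + m * (t + N)\<close> it becomes a partition outside \<open>durfee_partitions a m N n\<close>: its part number
  \<open>t + 1\<close> in the class of \<open>a\<close> is exactly \<open>a + m * (t + N)\<close>. Adding \<open>m\<close> to each of the \<open>t\<close>
  parts of \<open>U\<close> and lowering the extra part by \<open>m * t\<close> keeps the sum and gives a member of
  \<open>durfee_partitions a m (Suc N) n\<close>.
\<close>

definition split_pairs :: "nat \<Rightarrow> nat \<Rightarrow> nat \<Rightarrow> nat \<Rightarrow> (nat multiset \<times> nat multiset) set" where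
  "split_pairs a m N n = {(U, L).
     (\<forall>x\<in>#U. [x = a] (mod m) \<and> a + m * (size U + N) \<le> x) \<and>
     (\<forall>x\<in>#L. 0 < x \<and> ([x = a] (mod m) \<longrightarrow> x \<le> a + m * (size U + N))) \<and>
     (\<forall>j<N. a + m * j \<in># L) \<and>
     sum_mset U + sum_mset L + (a + m * (size U + N)) = n}"

lemma finite_staircase_partitions: "finite (staircase_partitions a m N n)"
  unfolding staircase_partitions_def using finite_partitions_of by simp

lemma durfee_subset_staircase: "durfee_partitions a m N n \<subseteq> staircase_partitions a m N n"
  unfolding durfee_partitions_def by blast

lemma class_tail_antimono:
  assumes "s \<le> s'"
  shows "class_tail a m s' P \<subseteq># class_tail a m s P"
proof -
  have "m * s \<le> m * s'" using assms by simp
  then have "a + m * s' \<le> x \<Longrightarrow> a + m * s \<le> x" for x by linarith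
  then show ?thesis unfolding class_tail_def by (intro mset_subset_eqI) auto
qed

lemma class_tail_eq_empty:
  assumes "\<And>x. x \<in># P \<Longrightarrow> [x = a] (mod m) \<Longrightarrow> x < a + m * s"
  shows "class_tail a m s P = {#}"
proof (rule ccontr)
  assume "class_tail a m s P \<noteq> {#}"
  then obtain x where "x \<in># class_tail a m s P" by (rule multiset_nonemptyE)
  then show False using assms[of x] by (auto simp: class_tail_def)
qed

text \<open>Consecutive members of the residue class differ by \<open>m\<close>, so there is none
  strictly between two neighbouring thresholds.\<close>

lemma cong_gt_imp_step_le:
  fixes a m s x :: nat
  assumes "[x = a] (mod m)" "a + m * s < x"
  shows "a + m * Suc s \<le> x"
proof -
  have "a \<le> x" using assms(2) by simp
  then obtain k where k: "x = k * m + a" using assms(1) cong_le_nat by blast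
  then have "m * s < m * k" using assms(2) by (simp add: mult.commute)
  then have "m * Suc s \<le> m * k" by (metis Suc_leI mult_le_mono2 mult_less_cancel1)
  then show ?thesis using k by (simp add: mult.commute)
qed

section \<open>The two partitions encoded by a pair\<close>

definition merge_split :: "nat \<Rightarrow> nat \<Rightarrow> nat \<Rightarrow> nat multiset \<times> nat multiset \<Rightarrow> nat multiset" where
  "merge_split a m N = (\<lambda>(U, L). add_mset (a + m * (size U + N)) (U + L))"

definition merge_shift :: "nat \<Rightarrow> nat \<Rightarrow> nat \<Rightarrow> nat multiset \<times> nat multiset \<Rightarrow> nat multiset" where
  "merge_shift a m N = (\<lambda>(U, L). add_mset (a + m * N) (image_mset ((+) m) U + L))"

text \<open>The extra part and all of \<open>U\<close> reach the threshold, while one step higher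
  nothing of \<open>L\<close> survives and only the parts of \<open>U\<close> above the threshold
  do. Hence the tail count exceeds \<open>size U\<close> at height \<open>size U + N\<close> and is
  at most \<open>size U\<close> at the next height, which pins down \<open>size U\<close>.\<close>

lemma merge_split_tail:
  assumes "(U, L) \<in> split_pairs a m N n" "m > 0"
  defines "P \<equiv> merge_split a m N (U, L)"
  shows "add_mset (a + m * (size U + N)) U \<subseteq># class_tail a m (size U + N) P"
    and "class_tail a m (size U + N + 1) P = filter_mset (\<lambda>x. a + m * (size U + N) < x) U"
proof -
  let ?v = "a + m * (size U + N)"
  have U: "\<forall>x\<in>#U. [x = a] (mod m) \<and> ?v \<le> x"
    and L: "\<forall>x\<in>#L. [x = a] (mod m) \<longrightarrow> x \<le> ?v"
    using assms(1) by (auto simp: split_pairs_def)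
  have "class_tail a m (size U + N) P = add_mset ?v (U + class_tail a m (size U + N) L)"
    using U by (auto simp: P_def merge_split_def class_tail_def cong_def filter_mset_eq_conv)
  then show "add_mset ?v U \<subseteq># class_tail a m (size U + N) P" by simp
  have "class_tail a m (size U + N + 1) L = {#}"
  proof (rule class_tail_eq_empty)
    fix x assume "x \<in># L" "[x = a] (mod m)"
    then have "x \<le> ?v" using L by blast
    then show "x < a + m * (size U + N + 1)" using assms(2) by simp
  qed
  moreover have "class_tail a m (size U + N + 1) U = filter_mset (\<lambda>x. ?v < x) U"
    unfolding class_tail_def
  proof (rule filter_mset_cong[OF refl])
    fix x assume "x \<in># U"
    then have "[x = a] (mod m)" using U by blast
    then show "([x = a] (mod m) \<and> a + m * (size U + N + 1) \<le> x) = (?v < x)"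
      using cong_gt_imp_step_le[of x a m "size U + N"] assms(2) by auto
  qed
  ultimately show "class_tail a m (size U + N + 1) P = filter_mset (\<lambda>x. ?v < x) U"
    using assms(2) by (simp add: P_def merge_split_def class_tail_def)
qed

text \<open>The parts above the lower bound together with the size determine \<open>U\<close>, since
  every other part equals the bound.\<close>

lemma filter_gt_plus_replicate:
  fixes v :: nat
  assumes "\<forall>x\<in>#U. v \<le> x"
  defines "W \<equiv> filter_mset (\<lambda>x. v < x) U"
  shows "U = W + replicate_mset (size U - size W) v"
proof -
  have eq: "U = W + replicate_mset (count U v) v"
  proof (rule multiset_eqI)
    fix x
    have "x < v \<Longrightarrow> count U x = 0" using assms(1) by (meson count_inI leD)
    then show "count U x = count (W + replicate_mset (count U v) v) x"
      unfolding W_def by (cases x v rule: linorder_cases) auto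
  qed
  have "size U = size W + count U v" using arg_cong[OF eq, of size] by simp
  then show ?thesis using eq by simp
qed

lemma inj_on_merge_split:
  assumes "m > 0"
  shows "inj_on (merge_split a m N) (split_pairs a m N n)"
proof (rule inj_onI, clarify)
  fix U L U' L'
  assume s: "(U, L) \<in> split_pairs a m N n" and s': "(U', L') \<in> split_pairs a m N n"
    and eq: "merge_split a m N (U, L) = merge_split a m N (U', L')"
  define P where "P = merge_split a m N (U, L)"
  have P': "P = merge_split a m N (U', L')" using eq P_def by simp
  note T = merge_split_tail[OF s assms, folded P_def]
  note T' = merge_split_tail[OF s' assms, folded P']
  have lo: "size U < size (class_tail a m (size U + N) P)"
    "size U' < size (class_tail a m (size U' + N) P)"
    using size_mset_mono[OF T(1)] size_mset_mono[OF T'(1)] by auto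
  have hi: "size (class_tail a m (size U + N + 1) P) \<le> size U"
    "size (class_tail a m (size U' + N + 1) P) \<le> size U'"
    unfolding T(2) T'(2) by (auto intro: size_mset_mono)
  \<comment> \<open>The tail at height \<open>size V' + N\<close> is contained in the tail at height
    \<open>size V + N + 1\<close>, so the two bounds would give
    \<open>size V' < size V\<close>.\<close>
  have no: False if "size V < size V'"
    "size V' < size (class_tail a m (size V' + N) P)"
    "size (class_tail a m (size V + N + 1) P) \<le> size V" for V V' :: "nat multiset"
    using that size_mset_mono[OF class_tail_antimono[of "size V + N + 1" "size V' + N" a m P]]
    by linarith
  have t: "size U = size U'" using no lo hi by (meson linorder_neqE_nat)
  let ?W = "class_tail a m (size U + N + 1) P" and ?v = "a + m * (size U + N)"
  have "U = ?W + replicate_mset (size U - size ?W) ?v"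
    unfolding T(2) by (rule filter_gt_plus_replicate) (use s in \<open>auto simp: split_pairs_def\<close>)
  moreover have "U' = ?W + replicate_mset (size U' - size ?W) ?v"
    unfolding t T'(2) by (rule filter_gt_plus_replicate) (use s' in \<open>auto simp: split_pairs_def\<close>)
  ultimately have "U = U'" using t by metis
  then show "U = U' \<and> L = L'" using eq by (simp add: merge_split_def)
qed

text \<open>Membership in \<open>durfee_partitions\<close> asks for a fixed point of the antitone
  tail count. Up to \<open>size U\<close> the count stays above the index, and from there on it
  stays below, so no fixed point exists.\<close>

lemma merge_split_in:
  assumes "(U, L) \<in> split_pairs a m N n" "m > 0" "a > 0"
  shows "merge_split a m N (U, L) \<in> staircase_partitions a m N n - durfee_partitions a m N n"
proof -
  let ?P = "merge_split a m N (U, L)"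
  have st: "?P \<in> staircase_partitions a m N n"
    using assms by (auto simp: staircase_partitions_def partitions_of_def split_pairs_def merge_split_def)
  note T = merge_split_tail[OF assms(1,2)]
  have "size (class_tail a m (s + N) ?P) \<noteq> s" for s
  proof (cases "s \<le> size U")
    case True
    have "s < size (class_tail a m (size U + N) ?P)"
      using size_mset_mono[OF T(1)] True by simp
    also have "\<dots> \<le> size (class_tail a m (s + N) ?P)"
      using True by (intro size_mset_mono class_tail_antimono) simp
    finally show ?thesis by simp
  next
    case False
    have "size (class_tail a m (s + N) ?P) \<le> size (class_tail a m (size U + N + 1) ?P)"
      using False by (intro size_mset_mono class_tail_antimono) simp
    also have "\<dots> \<le> size U" unfolding T(2) by (auto intro: size_mset_mono)
    finally show ?thesis using False by simp
  qed
  then show ?thesis using st by (auto simp: durfee_partitions_def)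
qed

text \<open>Without a fixed point the antitone count jumps from above the index to below it. At the
  jump, \<open>U\<close> collects the \<open>t\<close> largest parts of the class, padded with
  copies of the threshold, and one further copy is left to be the extra part.\<close>

lemma merge_split_surj:
  assumes P: "P \<in> staircase_partitions a m N n - durfee_partitions a m N n" and m: "m > 0"
  shows "P \<in> merge_split a m N ` split_pairs a m N n"
proof -
  let ?f = "\<lambda>s. size (class_tail a m (s + N) P)"
  have ne: "?f t \<noteq> t" for t using P by (auto simp: durfee_partitions_def)
  have "?f (size P + 1) \<le> size P"
    unfolding class_tail_def by (intro size_mset_mono) simp
  then have ex: "\<exists>t. ?f t < t" by (metis Suc_eq_plus1 less_Suc_eq_le)
  \<comment> \<open>The least index is positive because a count is never below \<open>0\<close>, so
    its predecessor \<open>t\<close> is the last index before the crossing.\<close>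
  define t where "t = (LEAST t. ?f t < t) - 1"
  have "?f (LEAST t. ?f t < t) < (LEAST t. ?f t < t)" using ex by (rule LeastI_ex)
  then have "(LEAST t. ?f t < t) = Suc t" unfolding t_def by simp
  with ex have hi: "?f (Suc t) \<le> t" and "\<not> ?f t < t"
    using LeastI_ex[OF ex] not_less_Least[of t "\<lambda>t. ?f t < t"] by auto
  then have lo: "t < ?f t" using ne[of t] by simp
  let ?v = "a + m * (t + N)"
  define W where "W = class_tail a m (Suc t + N) P"
  define U where "U = W + replicate_mset (t - size W) ?v"
  have szU: "size U = t" using hi by (simp add: U_def W_def)
  have W: "x \<in># W \<Longrightarrow> [x = a] (mod m) \<and> ?v < x" for x
    using m by (auto simp: W_def class_tail_def)
  have "class_tail a m (t + N) P = W + replicate_mset (count P ?v) ?v"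
  proof (rule multiset_eqI)
    fix x
    show "count (class_tail a m (t + N) P) x = count (W + replicate_mset (count P ?v) ?v) x"
      using cong_gt_imp_step_le[of x a m "t + N"] m
      by (cases "x = ?v") (auto simp: W_def class_tail_def cong_def)
  qed
  \<comment> \<open>Besides the copies of \<open>?v\<close> that pad \<open>W\<close> to size
    \<open>t\<close>, at least one more copy is available.\<close>
  then have cnt: "t < size W + count P ?v" using lo by simp
  have le: "add_mset ?v U \<subseteq># P"
  proof (rule mset_subset_eqI)
    fix x
    have "count W ?v = 0" using W by (auto simp: count_eq_zero_iff)
    moreover have "count W x \<le> count P x" unfolding W_def class_tail_def by simp
    ultimately show "count (add_mset ?v U) x \<le> count P x" using cnt hi
      by (auto simp: U_def W_def)
  qed
  define L where "L = P - add_mset ?v U"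
  have PL: "P = add_mset ?v (U + L)"
    using le by (metis L_def subset_mset.add_diff_inverse union_mset_add_mset_left)
  have pos: "\<forall>x\<in>#P. 0 < x" and sumP: "sum_mset P = n" and st: "\<forall>j<N. a + m * j \<in># P"
    using P by (auto simp: staircase_partitions_def partitions_of_def)
  have Uge: "[x = a] (mod m) \<and> ?v \<le> x" if "x \<in># U" for x
    using that W[of x] unfolding U_def by (auto simp: cong_def split: if_splits)
  have Lle: "x \<le> ?v" if "x \<in># L" "[x = a] (mod m)" for x
  proof (rule ccontr)
    assume gt: "\<not> x \<le> ?v"
    then have "a + m * (Suc t + N) \<le> x" using cong_gt_imp_step_le[of x a m "t + N"] that by simp
    \<comment> \<open>All copies of a class part above \<open>?v\<close> already lie in
      \<open>W\<close>, hence in \<open>U\<close>, which leaves none for \<open>L\<close>.\<close>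
    then have "count W x = count P x" using that by (simp add: W_def class_tail_def)
    moreover have "count P x = count U x + count L x" using PL gt by auto
    ultimately have "count L x = 0" using U_def by simp
    then show False using that by (simp add: count_eq_zero_iff)
  qed
  have "a + m * j \<in># L" if "j < N" for j
  proof -
    have "a + m * j < ?v" using that m by simp
    then have "a + m * j \<notin># add_mset ?v U" using Uge by fastforce
    then show ?thesis using st that PL by auto
  qed
  then have "(U, L) \<in> split_pairs a m N n"
    using Uge Lle pos sumP szU PL by (auto simp: split_pairs_def)
  moreover have "P = merge_split a m N (U, L)" using PL szU by (simp add: merge_split_def)
  ultimately show ?thesis by blast
qed

text \<open>After the shift every part of \<open>U\<close> clears the raised threshold, whereas
  class parts of \<open>L\<close> and the lowered part \<open>a + m * N\<close> stay below it. The
  tail is therefore the shifted \<open>U\<close>, of size exactly \<open>size U\<close>.\<close>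

lemma merge_shift_tail:
  assumes "(U, L) \<in> split_pairs a m N n" "m > 0"
  shows "class_tail a m (size U + Suc N) (merge_shift a m N (U, L)) = image_mset ((+) m) U"
proof -
  let ?v = "a + m * (size U + N)"
  have U: "\<forall>x\<in>#U. [x = a] (mod m) \<and> ?v \<le> x"
    and L: "\<forall>x\<in>#L. [x = a] (mod m) \<longrightarrow> x \<le> ?v"
    using assms(1) by (auto simp: split_pairs_def)
  have "class_tail a m (size U + Suc N) L = {#}"
  proof (rule class_tail_eq_empty)
    fix x assume "x \<in># L" "[x = a] (mod m)"
    then have "x \<le> ?v" using L by blast
    then show "x < a + m * (size U + Suc N)" using assms(2) by simp
  qed
  moreover have "class_tail a m (size U + Suc N) (image_mset ((+) m) U) = image_mset ((+) m) U"
    using U by (auto simp: class_tail_def filter_mset_eq_conv cong_def)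
  moreover have "m * N < m * (size U + Suc N)" using assms(2) by (simp only: mult_less_cancel1) simp
  then have "\<not> a + m * (size U + Suc N) \<le> a + m * N" by linarith
  ultimately show ?thesis unfolding merge_shift_def class_tail_def by simp
qed

lemma merge_shift_in:
  assumes "(U, L) \<in> split_pairs a m N n" "m > 0" "a > 0"
  shows "merge_shift a m N (U, L) \<in> durfee_partitions a m (Suc N) n"
proof -
  have "sum_mset (image_mset ((+) m) U) = m * size U + sum_mset U" for U :: "nat multiset"
    by (induction U) auto
  then have "merge_shift a m N (U, L) \<in> staircase_partitions a m (Suc N) n"
    using assms
    by (auto simp: staircase_partitions_def partitions_of_def split_pairs_def merge_shift_def
        less_Suc_eq algebra_simps)
  then show ?thesis using merge_shift_tail[OF assms(1,2)]
    unfolding durfee_partitions_def by (auto intro!: exI[of _ "size U"])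
qed

text \<open>An antitone count has at most one fixed point.\<close>

lemma durfee_height_unique:
  assumes "size (class_tail a m (t + N) P) = t" "size (class_tail a m (t' + N) P) = t'"
  shows "t = t'"
proof -
  have "s' \<le> s" if "s \<le> s'" "size (class_tail a m (s + N) P) = s"
    "size (class_tail a m (s' + N) P) = s'" for s s'
    using size_mset_mono[OF class_tail_antimono[of "s + N" "s' + N" a m P]] that by simp
  then show ?thesis using assms by (meson le_antisym nle_le)
qed

lemma inj_on_merge_shift:
  assumes "m > 0"
  shows "inj_on (merge_shift a m N) (split_pairs a m N n)"
proof (rule inj_onI, clarify)
  fix U L U' L'
  assume s: "(U, L) \<in> split_pairs a m N n" and s': "(U', L') \<in> split_pairs a m N n"
    and eq: "merge_shift a m N (U, L) = merge_shift a m N (U', L')"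
  note T = merge_shift_tail[OF s assms] and T' = merge_shift_tail[OF s' assms]
  have "size U = size U'"
    using durfee_height_unique[of a m "size U" "Suc N" "merge_shift a m N (U, L)" "size U'"] T
    unfolding eq T' by simp
  then have "image_mset ((+) m) U = image_mset ((+) m) U'" using T T' eq by simp
  then have "U = U'" by (metis multiset.inj_map injD inj_def add_left_imp_eq)
  then show "U = U' \<and> L = L'" using eq by (simp add: merge_shift_def)
qed

text \<open>The fixed point recovers \<open>t\<close>, and the tail at that height is the shifted
  \<open>U\<close>. Subtracting \<open>m\<close> from its parts and removing one
  \<open>a + m * N\<close> from the rest undoes the construction.\<close>

lemma merge_shift_surj:
  assumes P: "P \<in> durfee_partitions a m (Suc N) n" and m: "m > 0"
  shows "P \<in> merge_shift a m N ` split_pairs a m N n"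
proof -
  obtain t where t: "size (class_tail a m (t + Suc N) P) = t"
    using P by (auto simp: durfee_partitions_def)
  define W where "W = class_tail a m (t + Suc N) P"
  define U where "U = image_mset (\<lambda>x. x - m) W"
  define L where "L = P - W - {#a + m * N#}"
  let ?v = "a + m * (t + N)"
  have W: "x \<in># W \<Longrightarrow> [x = a] (mod m) \<and> ?v + m \<le> x" for x
    by (auto simp: W_def class_tail_def algebra_simps)
  have WU: "W = image_mset ((+) m) U"
  proof -
    have "image_mset ((+) m) U = image_mset id W"
      unfolding U_def multiset.map_comp
      by (rule image_mset_cong) (use W in fastforce)
    then show ?thesis by simp
  qed
  have pos: "\<forall>x\<in>#P. 0 < x" and sumP: "sum_mset P = n" and st: "\<forall>j<Suc N. a + m * j \<in># P"
    using P by (auto simp: durfee_partitions_def staircase_partitions_def partitions_of_def)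
  have PW: "P - W = filter_mset (\<lambda>x. \<not> ([x = a] (mod m) \<and> a + m * (t + Suc N) \<le> x)) P"
    unfolding W_def class_tail_def by (metis add_diff_cancel_left' multiset_partition)
  \<comment> \<open>The prescribed parts lie below the threshold of \<open>W\<close>, so removing
    \<open>W\<close> leaves all of them in place.\<close>
  have small: "a + m * j \<in># P - W" if "j \<le> N" for j
  proof -
    have "j < t + Suc N" using that by simp
    then have "m * j < m * (t + Suc N)" using m by (simp only: mult_less_cancel1)
    then show ?thesis unfolding PW using st that by auto
  qed
  have "W \<subseteq># P" unfolding W_def class_tail_def by simp
  then have PL: "P = add_mset (a + m * N) (W + L)"
    using small[of N] unfolding L_def
    by (metis add_mset_add_single insert_DiffM le_refl subset_mset.add_diff_inverse union_mset_add_mset_right)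
  have szU: "size U = t" using t by (simp add: U_def W_def)
  have Uge: "[x = a] (mod m) \<and> ?v \<le> x" if "x \<in># U" for x
  proof -
    have "m + x \<in># W" using that WU by simp
    from W[OF this] show ?thesis by (auto simp: cong_def)
  qed
  have "0 < x \<and> ([x = a] (mod m) \<longrightarrow> x \<le> ?v)" if "x \<in># L" for x
  proof -
    have "x \<in># P - W" using that unfolding L_def by (rule in_diffD)
    then have "x \<in># P" "\<not> ([x = a] (mod m) \<and> a + m * (t + Suc N) \<le> x)" unfolding PW by auto
    then show ?thesis using pos cong_gt_imp_step_le[of x a m "t + N"] by fastforce
  qed
  moreover have "a + m * j \<in># L" if "j < N" for j
  proof -
    have "a + m * j \<noteq> a + m * N" using that m by simp
    then show ?thesis using small[of j] that unfolding L_def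
      by (simp add: in_diff_count)
  qed
  moreover have "sum_mset W = m * size U + sum_mset U"
    unfolding WU by (induction U) auto
  then have "sum_mset U + sum_mset L + ?v = n"
    using sumP PL szU by (simp add: algebra_simps)
  ultimately have "(U, L) \<in> split_pairs a m N n"
    using Uge szU by (simp add: split_pairs_def)
  moreover have "P = merge_shift a m N (U, L)" using PL WU by (simp add: merge_shift_def)
  ultimately show ?thesis by blast
qed

text \<open>Both the complement of \<open>durfee_partitions a m N n\<close> and
  \<open>durfee_partitions a m (Suc N) n\<close> are injective images of the same set of
  pairs.\<close>

lemma card_durfee_rec:
  assumes "m > 0" "a > 0"
  shows "card (durfee_partitions a m N n) + card (durfee_partitions a m (Suc N) n)
    = card (staircase_partitions a m N n)"
proof -
  have "merge_split a m N ` split_pairs a m N n = staircase_partitions a m N n - durfee_partitions a m N n"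
    using merge_split_in merge_split_surj assms by fastforce
  then have "card (split_pairs a m N n) = card (staircase_partitions a m N n - durfee_partitions a m N n)"
    using card_image[OF inj_on_merge_split[OF assms(1)]] by metis
  moreover have "merge_shift a m N ` split_pairs a m N n = durfee_partitions a m (Suc N) n"
    using merge_shift_in merge_shift_surj assms by fastforce
  then have "card (split_pairs a m N n) = card (durfee_partitions a m (Suc N) n)"
    using card_image[OF inj_on_merge_shift[OF assms(1)]] by metis
  moreover have "card (durfee_partitions a m N n) \<le> card (staircase_partitions a m N n)"
    by (intro card_mono finite_staircase_partitions durfee_subset_staircase)
  moreover have "card (staircase_partitions a m N n - durfee_partitions a m N n)
    = card (staircase_partitions a m N n) - card (durfee_partitions a m N n)"
    by (rule card_Diff_subset[OF finite_subset[OF durfee_subset_staircase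
        finite_staircase_partitions] durfee_subset_staircase])
  ultimately show ?thesis by linarith
qed

section \<open>Durfee rectangles and staircases\<close>

text \<open>In a weakly decreasing list the entries reaching \<open>s\<close> form an initial
  segment.\<close>

lemma desc_nth_ge_iff:
  fixes ls :: "nat list"
  assumes "sorted (rev ls)" "i < length ls"
  shows "s \<le> ls ! i \<longleftrightarrow> i < length (filter (\<lambda>y. s \<le> y) ls)"
  using assms
proof (induction ls arbitrary: i)
  case (Cons x xs)
  have le: "y \<le> x" if "y \<in> set xs" for y using Cons.prems(1) that by (auto simp: sorted_append)
  have srt: "sorted (rev xs)" using Cons.prems(1) by (simp add: sorted_append)
  show ?case
  proof (cases "s \<le> x")
    case True
    then show ?thesis using Cons.IH[OF srt] Cons.prems(2) by (cases i) auto
  next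
    case False
    then have "filter (\<lambda>y. s \<le> y) xs = []" using le by (force simp: filter_empty_conv)
    moreover have "(x # xs) ! i \<le> x" using le Cons.prems(2) by (cases i) auto
    ultimately show ?thesis using False by simp
  qed
qed simp

text \<open>With \<open>c s\<close> the number of rows of length at least \<open>s + d\<close>, a
  height \<open>t\<close> is admissible iff \<open>t \<le> c t\<close>, and the condition on the
  later rows says \<open>c t \<le> t\<close>. Together they give a fixed point. Conversely, a fixed
  point is admissible, so it is at most the maximal height, where the antitone \<open>c\<close> can
  only be smaller.\<close>

lemma durfee_height_condition_iff:
  assumes "sorted (rev ls)"
  shows "(let t = durfee_height d ls in \<forall>i. t < i \<and> i \<le> length ls \<longrightarrow> ls ! (i - 1) < t + d)
    \<longleftrightarrow> (\<exists>t. length (filter (\<lambda>y. t + d \<le> y) ls) = t)"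
proof -
  define c where "c s = length (filter (\<lambda>y. s + d \<le> y) ls)" for s
  have c_le: "c s \<le> length ls" for s by (simp add: c_def)
  have c_anti: "c s' \<le> c s" if "s \<le> s'" for s s'
  proof -
    have "mset (filter (\<lambda>y. s' + d \<le> y) ls) \<subseteq># mset (filter (\<lambda>y. s + d \<le> y) ls)"
      using that by (auto intro!: mset_subset_eqI)
    then show ?thesis unfolding c_def by (metis size_mset size_mset_mono)
  qed
  have nth: "s + d \<le> ls ! (i - 1) \<longleftrightarrow> i \<le> c s" if "0 < i" "i \<le> length ls" for i s
    using desc_nth_ge_iff[OF assms, of "i - 1" "s + d"] that by (auto simp: c_def)
  define S where "S = {t. t \<le> length ls \<and> (0 < t \<longrightarrow> t + d \<le> ls ! (t - 1))}"
  have S: "t \<in> S \<longleftrightarrow> t \<le> c t" for t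
    using nth[of t t] c_le[of t] by (cases "t = 0") (auto simp: S_def)
  have "finite S" by (rule finite_subset[of _ "{..length ls}"]) (auto simp: S_def)
  moreover have "0 \<in> S" by (simp add: S_def)
  ultimately have max: "Max S \<in> S" "\<And>t. t \<in> S \<Longrightarrow> t \<le> Max S" by (auto intro: Max_in)
  have "(\<forall>i. t < i \<and> i \<le> length ls \<longrightarrow> ls ! (i - 1) < t + d) \<longleftrightarrow> c t \<le> t" for t
  proof
    assume *: "\<forall>i. t < i \<and> i \<le> length ls \<longrightarrow> ls ! (i - 1) < t + d"
    show "c t \<le> t"
    proof (rule ccontr)
      assume "\<not> c t \<le> t"
      then show False using *[rule_format, of "c t"] nth[of "c t" t] c_le[of t] by auto
    qed
  next
    assume "c t \<le> t"
    then show "\<forall>i. t < i \<and> i \<le> length ls \<longrightarrow> ls ! (i - 1) < t + d"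
      using nth by (metis gr0I leD le_trans not_le_imp_less not_less_zero)
  qed
  moreover have "c (Max S) \<le> Max S \<longleftrightarrow> (\<exists>t. c t = t)"
  proof
    assume "c (Max S) \<le> Max S"
    then show "\<exists>t. c t = t" using max(1) S by (auto intro!: exI[of _ "Max S"])
  next
    assume "\<exists>t. c t = t"
    then obtain t where t: "c t = t" by blast
    then have "t \<le> Max S" using S max(2) by simp
    then show "c (Max S) \<le> Max S" using c_anti[of t "Max S"] t by simp
  qed
  ultimately show ?thesis by (simp add: durfee_height_def S_def c_def)
qed

lemma sorted_rev_modular_rows: "sorted (rev (modular_rows a m P))"
proof -
  have "rev (modular_rows a m P) = map (\<lambda>x. (x - a) div m + 1) (sorted_list_of_multiset P)"
    by (simp add: modular_rows_def rev_map)
  moreover have "sorted (map (\<lambda>x. (x - a) div m + 1) xs)" if "sorted xs" for xs :: "nat list"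
    using that by (induction xs) (auto simp: div_le_mono)
  ultimately show ?thesis by (simp add: sorted_sorted_list_of_multiset)
qed

lemma length_filter_modular_rows:
  "length (filter Q (modular_rows a m P)) = size (filter_mset (\<lambda>x. Q ((x - a) div m + 1)) P)"
proof -
  have "mset (modular_rows a m P) = image_mset (\<lambda>x. (x - a) div m + 1) P"
    by (simp add: modular_rows_def)
  then have "mset (filter Q (modular_rows a m P))
      = filter_mset Q (image_mset (\<lambda>x. (x - a) div m + 1) P)" by simp
  then show ?thesis by (metis size_mset filter_mset_image_mset size_image_mset)
qed

lemma row_length_ge_iff:
  fixes a m s x :: nat
  assumes "[x = a] (mod m)" "a < m"
  shows "s + 1 \<le> (x - a) div m + 1 \<longleftrightarrow> a + m * s \<le> x"
proof -
  have "x mod m = a" using assms by (simp add: cong_def)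
  then have "a \<le> x" by (metis mod_less_eq_dividend)
  then show ?thesis using assms(2) by (simp add: less_eq_div_iff_mult_less_eq mult.commute le_diff_conv2 add.commute)
qed

lemma p_amnu_eq_card_durfee:
  assumes "a < m"
  shows "p_amnu a m \<nu> n = card (durfee_partitions a m (Suc \<nu>) n)"
proof -
  have "filter_mset (\<lambda>x. [x = a] (mod m)) P
      \<in> M_partitions a m \<nu> (n - sum_mset (filter_mset (\<lambda>x. \<not> [x = a] (mod m)) P))
      \<longleftrightarrow> (\<forall>j<Suc \<nu>. a + m * j \<in># P) \<and> (\<exists>t. size (class_tail a m (t + Suc \<nu>) P) = t)"
    if P: "P \<in> partitions_of n" for P
  proof -
    define C where "C = filter_mset (\<lambda>x. [x = a] (mod m)) P"
    define D where "D = filter_mset (\<lambda>x. \<not> [x = a] (mod m)) P"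
    have "P = C + D" unfolding C_def D_def by (rule multiset_partition)
    then have sumC: "sum_mset C = n - sum_mset D" using P by (auto simp: partitions_of_def)
    \<comment> \<open>The part \<open>a + m * s\<close> has \<open>s + 1\<close> boxes, so a width
      of \<open>t + \<nu> + 2\<close> boxes becomes the multiplier
      \<open>t + Suc \<nu>\<close>.\<close>
    have "filter_mset (\<lambda>x. t + (\<nu> + 2) \<le> (x - a) div m + 1) C = class_tail a m (t + Suc \<nu>) P" for t
    proof -
      have "filter_mset (\<lambda>x. t + (\<nu> + 2) \<le> (x - a) div m + 1) C = filter_mset (\<lambda>x. a + m * (t + Suc \<nu>) \<le> x) C"
      proof (rule filter_mset_cong[OF refl])
        fix x assume "x \<in># C"
        then have "[x = a] (mod m)" by (simp add: C_def)
        from row_length_ge_iff[OF this assms, of "t + Suc \<nu>"]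
        show "(t + (\<nu> + 2) \<le> (x - a) div m + 1) = (a + m * (t + Suc \<nu>) \<le> x)" by simp
      qed
      also have "\<dots> = class_tail a m (t + Suc \<nu>) P"
        unfolding C_def class_tail_def filter_filter_mset by (rule filter_mset_cong) auto
      finally show ?thesis .
    qed
    then have "(let t = durfee_height (\<nu> + 2) (modular_rows a m C) in
          \<forall>i. t < i \<and> i \<le> length (modular_rows a m C) \<longrightarrow> modular_rows a m C ! (i - 1) < t + (\<nu> + 2))
        \<longleftrightarrow> (\<exists>t. size (class_tail a m (t + Suc \<nu>) P) = t)"
      using durfee_height_condition_iff[OF sorted_rev_modular_rows, of "\<nu> + 2" a m C]
      unfolding length_filter_modular_rows by simp
    moreover have "(\<forall>j\<le>\<nu>. a + m * j \<in># C) \<longleftrightarrow> (\<forall>j<Suc \<nu>. a + m * j \<in># P)"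
      by (auto simp: C_def cong_def less_Suc_eq_le)
    moreover have "C \<in> partitions_of (n - sum_mset D)" "\<forall>x\<in>#C. [x = a] (mod m)"
      using P sumC by (auto simp: C_def partitions_of_def)
    ultimately show ?thesis
      unfolding C_def[symmetric] D_def[symmetric] M_partitions_def by (simp add: Let_def add.assoc)
  qed
  then have "{P \<in> partitions_of n.
        let \<beta> = sum_mset (filter_mset (\<lambda>x. \<not> [x = a] (mod m)) P)
        in filter_mset (\<lambda>x. [x = a] (mod m)) P \<in> M_partitions a m \<nu> (n - \<beta>)}
      = durfee_partitions a m (Suc \<nu>) n"
    unfolding durfee_partitions_def staircase_partitions_def Let_def by blast
  then show ?thesis by (simp add: p_amnu_def)
qed

section \<open>Counting partitions with prescribed parts\<close>

lemma card_partitions_superset: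
  assumes "\<forall>x\<in>#S. 0 < x"
  shows "card {P \<in> partitions_of n. S \<subseteq># P}
    = (if sum_mset S \<le> n then num_partitions (n - sum_mset S) else 0)"
proof (cases "sum_mset S \<le> n")
  case True
  have "{P \<in> partitions_of n. S \<subseteq># P} = (+) S ` partitions_of (n - sum_mset S)"
  proof (intro equalityI subsetI)
    fix P assume "P \<in> {P \<in> partitions_of n. S \<subseteq># P}"
    then obtain R where "P = S + R" "P \<in> partitions_of n" by (auto simp: mset_subset_eq_exists_conv)
    then show "P \<in> (+) S ` partitions_of (n - sum_mset S)" by (auto simp: partitions_of_def)
  qed (use assms True in \<open>auto simp: partitions_of_def\<close>)
  then show ?thesis using True by (simp add: card_image num_partitions_def)
next
  case False
  then have "{P \<in> partitions_of n. S \<subseteq># P} = {}"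
    by (auto simp: partitions_of_def mset_subset_eq_exists_conv)
  then show ?thesis using False by (simp only: card.empty if_False)
qed

lemma card_staircase_partitions:
  assumes "a > 0" "m > 0"
  shows "card (staircase_partitions a m N n)
    = (if (\<Sum>j<N. a + m * j) \<le> n then num_partitions (n - (\<Sum>j<N. a + m * j)) else 0)"
proof -
  define S where "S = image_mset (\<lambda>j. a + m * j) (mset_set {..<N})"
  have inj: "inj_on (\<lambda>j. a + m * j) {..<N}" using assms(2) by (auto simp: inj_on_def)
  \<comment> \<open>The prescribed parts are distinct since \<open>m > 0\<close>, so containing each
    of them is the same as containing the multiset \<open>S\<close>.\<close>
  have S: "S = mset_set ((\<lambda>j. a + m * j) ` {..<N})"
    unfolding S_def by (rule image_mset_mset_set[OF inj])
  have "(\<forall>j<N. a + m * j \<in># P) \<longleftrightarrow> S \<subseteq># P" for P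
  proof
    assume "\<forall>j<N. a + m * j \<in># P"
    then have "S \<subseteq># mset_set (set_mset P)"
      unfolding S by (intro subset_imp_msubset_mset_set) auto
    then show "S \<subseteq># P" using mset_set_set_mset_msubset subset_mset.order_trans by blast
  next
    assume "S \<subseteq># P"
    then have "set_mset S \<subseteq> set_mset P" by (rule set_mset_mono)
    then show "\<forall>j<N. a + m * j \<in># P" unfolding S by auto
  qed
  moreover have "sum_mset S = (\<Sum>j<N. a + m * j)" by (simp add: S_def sum_unfold_sum_mset)
  moreover have "\<forall>x\<in>#S. 0 < x" using assms(1) by (simp add: S_def)
  ultimately show ?thesis
    using card_partitions_superset[of S n] by (simp add: staircase_partitions_def)
qed

text \<open>The sum telescopes by \<open>card_durfee_rec\<close>. The lower end is left free because
  the class of 3 starts at \<open>0\<close> and the class of 1 at \<open>1\<close>.\<close>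

lemma alternating_staircase_sum:
  assumes "m > 0" "a > 0"
  shows "(\<Sum>\<tau>=k..<k + l. (-1) ^ \<tau> * int (card (staircase_partitions a m \<tau> n)))
    = (-1) ^ k * int (card (durfee_partitions a m k n))
      - (-1) ^ (k + l) * int (card (durfee_partitions a m (k + l) n))"
  by (induction l) (simp_all add: card_durfee_rec[OF assms, symmetric] algebra_simps)

section \<open>The finite Jacobi triple product\<close>

text \<open>Gaussian binomial coefficients, given by the q-Pascal rule so that they make sense in
  every commutative ring without division.\<close>

fun qbinom :: "'a::comm_ring_1 \<Rightarrow> nat \<Rightarrow> nat \<Rightarrow> 'a" where
  "qbinom q n 0 = 1"
| "qbinom q 0 (Suc k) = 0"
| "qbinom q (Suc n) (Suc k) = qbinom q n k + q ^ Suc k * qbinom q n (Suc k)"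

definition qpoch :: "'a::comm_ring_1 \<Rightarrow> nat \<Rightarrow> 'a" where
  "qpoch q n = (\<Prod>i<n. 1 - q ^ Suc i)"

lemma qpoch_0 [simp]: "qpoch q 0 = 1"
  by (simp add: qpoch_def)

lemma qpoch_Suc: "qpoch q (Suc n) = qpoch q n * (1 - q ^ Suc n)"
  by (simp add: qpoch_def)

lemma qbinom_eq_0: "n < k \<Longrightarrow> qbinom q n k = 0"
  by (induction q n k rule: qbinom.induct) auto

text \<open>The quotient formula with denominators cleared. With \<open>n = Suc j + l\<close> the
  induction rests on \<open>(1 - q ^ Suc j) + q ^ Suc j * (1 - q ^ Suc l) = 1 - q ^ Suc
  n\<close>.\<close>

lemma qbinom_mult_qpoch:
  assumes "k \<le> n"
  shows "qbinom q n k * qpoch q k * qpoch q (n - k) = qpoch q n"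
  using assms
proof (induction n arbitrary: k)
  case (Suc n)
  show ?case
  proof (cases k)
    case (Suc j)
    have IH: "qbinom q n j * qpoch q j * qpoch q (n - j) = qpoch q n"
      using Suc.IH[of j] Suc.prems Suc by simp
    show ?thesis
    proof (cases "j = n")
      case True
      then show ?thesis using IH Suc by (simp add: qpoch_Suc qbinom_eq_0 flip: mult.assoc)
    next
      case False
      then have "j < n" using Suc Suc.prems by simp
      then obtain l where l: "n - j = Suc l" "n - Suc j = l" "n = Suc j + l"
        by (metis Suc_diff_Suc add_diff_inverse_nat le_add_diff_inverse less_eq_Suc_le)
      have IH2: "qbinom q n (Suc j) * qpoch q (Suc j) * qpoch q l = qpoch q n"
        using Suc.IH[of "Suc j"] \<open>j < n\<close> l(2) by simp
      have "qbinom q (Suc n) k * qpoch q k * qpoch q (Suc n - k)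
          = (qbinom q n j * qpoch q j * qpoch q (n - j)) * (1 - q ^ Suc j)
          + q ^ Suc j * (qbinom q n (Suc j) * qpoch q (Suc j) * qpoch q l) * (1 - q ^ Suc l)"
        by (simp add: Suc l(1) qpoch_Suc algebra_simps del: power_Suc)
      also have "\<dots> = qpoch q n * (1 - q ^ Suc j * q ^ Suc l)"
        unfolding IH IH2 by (simp add: algebra_simps del: power_Suc)
      also have "q ^ Suc j * q ^ Suc l = q ^ Suc n"
        unfolding l(3) by (simp add: power_add mult_ac)
      finally show ?thesis by (simp only: qpoch_Suc)
    qed
  qed simp
qed simp

lemma Suc_choose_two: "Suc k choose 2 = (k choose 2) + k"
  by (simp add: numeral_2_eq_2)

text \<open>Splitting off the factor \<open>i = 0\<close> turns \<open>b\<close> into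
  \<open>b * q\<close>, whence the induction over arbitrary \<open>b\<close>. The homogeneous form
  in \<open>a\<close> and \<open>b\<close> later avoids negative powers.\<close>

lemma q_binomial_theorem:
  fixes a b q :: "'a::comm_ring_1"
  shows "(\<Prod>i<n. a + b * q ^ i) = (\<Sum>k\<le>n. q ^ (k choose 2) * qbinom q n k * a ^ (n - k) * b ^ k)"
proof (induction n arbitrary: b)
  case (Suc n)
  define t where "t k = q ^ (k choose 2) * qbinom q n k * a ^ (n - k) * (b * q) ^ k" for k
  have t0: "t 0 = a ^ n" by (simp add: t_def numeral_2_eq_2)
  have "(\<Prod>i<Suc n. a + b * q ^ i) = (a + b) * (\<Prod>i<n. a + (b * q) * q ^ i)"
    by (simp only: prod.lessThan_Suc_shift) (simp add: mult.assoc)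
  also have "\<dots> = (a + b) * (\<Sum>k\<le>n. t k)"
    by (simp only: Suc.IH t_def)
  also have "\<dots> = a * t 0 + (\<Sum>k<n. a * t (Suc k)) + (\<Sum>k\<le>n. b * t k)"
  proof -
    have "(\<Sum>k\<le>n. t k) = t 0 + (\<Sum>k<n. t (Suc k))" by (simp add: sum.atMost_shift)
    then have "a * (\<Sum>k\<le>n. t k) = a * t 0 + (\<Sum>k<n. a * t (Suc k))"
      by (simp add: distrib_left sum_distrib_left)
    moreover have "b * (\<Sum>k\<le>n. t k) = (\<Sum>k\<le>n. b * t k)" by (rule sum_distrib_left)
    ultimately show ?thesis by (simp only: distrib_right)
  qed
  \<comment> \<open>The range may grow to include \<open>k = n\<close> because
    \<open>qbinom q n (Suc n) = 0\<close>. Both sums then match the two terms of the q-Pascal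
    rule.\<close>
  also have "(\<Sum>k<n. a * t (Suc k))
      = (\<Sum>k\<le>n. q ^ (Suc k choose 2) * (q ^ Suc k * qbinom q n (Suc k)) * a ^ (n - k) * b ^ Suc k)"
  proof -
    have "a * t (Suc k) = q ^ (Suc k choose 2) * (q ^ Suc k * qbinom q n (Suc k)) * a ^ (n - k) * b ^ Suc k"
      if "k < n" for k
    proof -
      have "a ^ (n - k) = a * a ^ (n - Suc k)" using that by (metis Suc_diff_Suc power_Suc)
      then show ?thesis by (simp add: t_def power_mult_distrib mult_ac)
    qed
    then show ?thesis by (simp add: qbinom_eq_0 flip: lessThan_Suc_atMost)
  qed
  also have "(\<Sum>k\<le>n. b * t k) = (\<Sum>k\<le>n. q ^ (Suc k choose 2) * qbinom q n k * a ^ (n - k) * b ^ Suc k)"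
    by (simp add: t_def Suc_choose_two power_add power_mult_distrib mult_ac)
  finally show ?case
    by (simp only: t0 sum.atMost_Suc_shift sum.distrib[symmetric]) 
      (simp add: sum.distrib algebra_simps numeral_2_eq_2)
qed (simp add: numeral_2_eq_2)

text \<open>One integer index covers both families of exponents: \<open>j = -\<tau>\<close> gives
  \<open>\<tau> * (2 * \<tau> + 1)\<close> and \<open>j = \<tau> + 1\<close> gives
  \<open>(\<tau> + 1) * (2 * \<tau> + 1)\<close>.\<close>

definition theta_exp :: "int \<Rightarrow> nat" where
  "theta_exp j = nat (j * (2 * j - 1))"

lemma int_theta_exp: "int (theta_exp j) = j * (2 * j - 1)"
proof -
  have "0 \<le> j * (2 * j - 1)" by (cases "j \<le> 0") (auto simp: mult_nonpos_nonpos)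
  then show ?thesis by (simp add: theta_exp_def)
qed

text \<open>In the lower half of the product the power \<open>(x ^ 4) ^ i\<close> is the smaller one
  and is pulled out with a sign, leaving exponents congruent to 3 modulo 4. In the upper half
  \<open>x ^ (4 * N - 1)\<close> is pulled out, leaving exponents congruent to 1.\<close>

lemma finite_jacobi_product:
  fixes x :: "'a::comm_ring_1"
  assumes "N > 0"
  shows "(\<Prod>i<2 * N. x ^ (4 * N - 1) + (-1) * (x ^ 4) ^ i)
    = (-1) ^ N * x ^ (3 * N * (2 * N - 1)) * (\<Prod>i<N. (1 - x ^ (4 * i + 1)) * (1 - x ^ (4 * i + 3)))"
proof -
  let ?f = "\<lambda>i. x ^ (4 * N - 1) + (-1) * (x ^ 4) ^ i"
  have "(\<Prod>i<2 * N. ?f i) = (\<Prod>i<N. ?f i) * (\<Prod>i<N. ?f (N + i))"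
  proof -
    have "(\<Prod>i<N + l. ?f i) = (\<Prod>i<N. ?f i) * (\<Prod>i<l. ?f (N + i))" for l
      by (induction l) (simp_all add: mult.assoc)
    from this[of N] show ?thesis by (simp add: mult_2)
  qed
  also have "(\<Prod>i<N. ?f i) = (\<Prod>i<N. ?f (N - Suc i))"
    by (rule prod.nat_diff_reindex[symmetric])
  also have "\<dots> = (\<Prod>i<N. (-1) * x ^ (4 * (N - Suc i)) * (1 - x ^ (4 * i + 3)))"
  proof (rule prod.cong[OF refl])
    fix i assume "i \<in> {..<N}"
    then have "4 * N - 1 = 4 * (N - Suc i) + (4 * i + 3)" by auto
    then have "x ^ (4 * N - 1) = x ^ (4 * (N - Suc i)) * x ^ (4 * i + 3)" by (simp only: power_add)
    then show "?f (N - Suc i) = (-1) * x ^ (4 * (N - Suc i)) * (1 - x ^ (4 * i + 3))"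
      by (simp only: power_mult) (simp add: algebra_simps)
  qed
  also have "(\<Prod>i<N. ?f (N + i)) = (\<Prod>i<N. x ^ (4 * N - 1) * (1 - x ^ (4 * i + 1)))"
  proof (rule prod.cong[OF refl])
    fix i
    have "4 * (N + i) = (4 * N - 1) + (4 * i + 1)" using assms by simp
    then have "(x ^ 4) ^ (N + i) = x ^ (4 * N - 1) * x ^ (4 * i + 1)"
      by (metis power_add power_mult)
    then show "?f (N + i) = x ^ (4 * N - 1) * (1 - x ^ (4 * i + 1))"
      by (simp only:) (simp add: algebra_simps)
  qed
  finally have "(\<Prod>i<2 * N. ?f i) = (\<Prod>i<N. (-1) * x ^ (4 * (N - Suc i)) * (1 - x ^ (4 * i + 3)))
     * (\<Prod>i<N. x ^ (4 * N - 1) * (1 - x ^ (4 * i + 1)))" .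
  also have "\<dots> = (-1) ^ N * ((\<Prod>i<N. x ^ (4 * (N - Suc i))) * (x ^ (4 * N - 1)) ^ N)
     * (\<Prod>i<N. (1 - x ^ (4 * i + 1)) * (1 - x ^ (4 * i + 3)))"
    unfolding prod.distrib by (simp add: mult_ac)
  also have "(\<Prod>i<N. x ^ (4 * (N - Suc i))) * (x ^ (4 * N - 1)) ^ N = x ^ (3 * N * (2 * N - 1))"
  proof -
    have "(\<Prod>i<N. x ^ (4 * (N - Suc i))) = (\<Prod>i<N. x ^ (4 * i))"
      by (rule prod.nat_diff_reindex)
    also have "\<dots> = x ^ (\<Sum>i<N. 4 * i)" by (simp add: power_sum)
    finally have "(\<Prod>i<N. x ^ (4 * (N - Suc i))) * (x ^ (4 * N - 1)) ^ N = x ^ ((\<Sum>i<N. 4 * i) + (4 * N - 1) * N)"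
      by (simp add: power_add flip: power_mult)
    moreover have "(\<Sum>i<n. 4 * i) = 2 * n * (n - 1)" for n :: nat
    proof (induction n)
      case (Suc n) then show ?case by (cases n) (simp_all add: algebra_simps)
    qed simp
    moreover have "2 * N * (N - 1) + (4 * N - 1) * N = 3 * N * (2 * N - 1)"
      using assms by (cases N) (auto simp: algebra_simps)
    ultimately show ?thesis by simp
  qed
  finally show ?thesis .
qed

text \<open>
  The finite form of Jacobi's triple product: \<open>k = N + j\<close> corresponds to the term of index
  \<open>j\<close> of the theta series.
\<close>

lemma finite_jacobi_triple_product:
  fixes x :: "'a::idom"
  assumes "x \<noteq> 0" "N > 0"
  shows "(\<Sum>k\<le>2 * N. (-1) ^ (k + N) * x ^ theta_exp (int k - int N) * qbinom (x ^ 4) (2 * N) k)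
    = (\<Prod>i<N. (1 - x ^ (4 * i + 1)) * (1 - x ^ (4 * i + 3)))"
proof -
  \<comment> \<open>This is the monomial pulled out of the product. It is nonzero in the domain and
    cancels at the end.\<close>
  let ?c = "(-1) ^ N * x ^ (3 * N * (2 * N - 1))"
  have "?c * (\<Sum>k\<le>2 * N. (-1) ^ (k + N) * x ^ theta_exp (int k - int N) * qbinom (x ^ 4) (2 * N) k)
      = (\<Sum>k\<le>2 * N. (x ^ 4) ^ (k choose 2) * qbinom (x ^ 4) (2 * N) k * (x ^ (4 * N - 1)) ^ (2 * N - k) * (-1) ^ k)"
    unfolding sum_distrib_left
  proof (rule sum.cong[OF refl])
    fix k assume "k \<in> {..2 * N}"
    then have k: "k \<le> 2 * N" by simp
    have ch: "2 * int (k choose 2) = int k * (int k - 1)"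
    proof (induction k)
      case (Suc k) then show ?case unfolding Suc_choose_two by (simp add: algebra_simps)
    qed simp
    \<comment> \<open>The exponents are compared over the integers, where the subtractions are not
      truncated.\<close>
    have "int (4 * (k choose 2) + (4 * N - 1) * (2 * N - k))
        = 2 * (2 * int (k choose 2)) + (4 * int N - 1) * (2 * int N - int k)"
      using k assms(2) by (simp add: of_nat_diff)
    also have "\<dots> = int (3 * N * (2 * N - 1) + theta_exp (int k - int N))"
    proof -
      have "int (3 * N * (2 * N - 1)) = 3 * int N * (2 * int N - 1)"
        using assms(2) by (simp add: of_nat_diff)
      then show ?thesis unfolding ch of_nat_add int_theta_exp by (simp add: algebra_simps)
    qed
    finally have e: "4 * (k choose 2) + (4 * N - 1) * (2 * N - k) = 3 * N * (2 * N - 1) + theta_exp (int k - int N)"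
      by (simp only: of_nat_eq_iff)
    have "?c * ((-1) ^ (k + N) * x ^ theta_exp (int k - int N) * qbinom (x ^ 4) (2 * N) k)
        = ((-1) ^ N * (-1) ^ (k + N)) * (x ^ (3 * N * (2 * N - 1)) * x ^ theta_exp (int k - int N))
          * qbinom (x ^ 4) (2 * N) k"
      by (simp only: mult_ac)
    also have "(-1) ^ N * (-1) ^ (k + N) = ((-1) ^ k :: 'a)"
      by (simp add: minus_one_power_iff)
    also have "x ^ (3 * N * (2 * N - 1)) * x ^ theta_exp (int k - int N)
        = (x ^ 4) ^ (k choose 2) * (x ^ (4 * N - 1)) ^ (2 * N - k)"
      unfolding power_mult[symmetric] power_add[symmetric] e ..
    finally show "?c * ((-1) ^ (k + N) * x ^ theta_exp (int k - int N) * qbinom (x ^ 4) (2 * N) k)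
        = (x ^ 4) ^ (k choose 2) * qbinom (x ^ 4) (2 * N) k * (x ^ (4 * N - 1)) ^ (2 * N - k) * (-1) ^ k"
      by (simp only: mult_ac)
  qed
  also have "\<dots> = ?c * (\<Prod>i<N. (1 - x ^ (4 * i + 1)) * (1 - x ^ (4 * i + 3)))"
    unfolding q_binomial_theorem[symmetric] by (rule finite_jacobi_product[OF assms(2)])
  finally show ?thesis using assms(1) by simp
qed

section \<open>Passage to the limit\<close>

text \<open>The product of \<open>1 / (1 - X ^ a)\<close> over positive \<open>a\<close> in
  \<open>A\<close>, given by its coefficients so that only finite products have to be
  handled.\<close>

definition gen_partitions :: "nat set \<Rightarrow> int fps" where
  "gen_partitions A = Abs_fps (\<lambda>n. int (card {P \<in> partitions_of n. set_mset P \<subseteq> A}))"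

lemma gen_partitions_nth:
  "fps_nth (gen_partitions A) n = int (card {P \<in> partitions_of n. set_mset P \<subseteq> A})"
  by (simp add: gen_partitions_def)

lemma gen_partitions_nth_cong:
  assumes "\<And>x. 0 < x \<Longrightarrow> x \<le> n \<Longrightarrow> x \<in> A \<longleftrightarrow> x \<in> B"
  shows "fps_nth (gen_partitions A) n = fps_nth (gen_partitions B) n"
proof -
  have "0 < x \<and> x \<le> n" if "P \<in> partitions_of n" "x \<in># P" for P x
    using that by (auto simp: partitions_of_def dest: multi_member_split)
  then have "{P \<in> partitions_of n. set_mset P \<subseteq> A} = {P \<in> partitions_of n. set_mset P \<subseteq> B}"
    using assms by (auto simp: subset_iff)
  then show ?thesis by (simp add: gen_partitions_nth)
qed

text \<open>Deleting one copy of \<open>a\<close> matches the partitions of \<open>n\<close>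
  containing \<open>a\<close> with those of \<open>n - a\<close>; subtracting them leaves the
  partitions avoiding \<open>a\<close>.\<close>

lemma gen_partitions_remove_part:
  assumes "a \<in> A" "a > 0"
  shows "gen_partitions A * (1 - fps_X ^ a) = gen_partitions (A - {a})"
proof (rule fps_ext)
  fix n
  let ?c = "\<lambda>A n. {P \<in> partitions_of n. set_mset P \<subseteq> A}"
  have "card (?c A n) = card (?c (A - {a}) n \<union> {P \<in> ?c A n. a \<in># P})"
    by (rule arg_cong[of _ _ card]) auto
  also have "\<dots> = card (?c (A - {a}) n) + card {P \<in> ?c A n. a \<in># P}"
    using finite_partitions_of[of n] by (intro card_Un_disjoint) auto
  finally have "card (?c A n) = card (?c (A - {a}) n) + card {P \<in> ?c A n. a \<in># P}" .
  moreover have "card {P \<in> ?c A n. a \<in># P} = (if a \<le> n then card (?c A (n - a)) else 0)"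
  proof (cases "a \<le> n")
    case True
    have "{P \<in> ?c A n. a \<in># P} = add_mset a ` ?c A (n - a)"
    proof (intro equalityI subsetI)
      fix P assume P: "P \<in> {P \<in> ?c A n. a \<in># P}"
      then obtain R where "P = add_mset a R" by (auto dest: multi_member_split)
      then show "P \<in> add_mset a ` ?c A (n - a)" using P by (auto simp: partitions_of_def)
    qed (use assms True in \<open>auto simp: partitions_of_def\<close>)
    then show ?thesis using True by (simp add: card_image inj_on_def)
  next
    case False
    then have "{P \<in> ?c A n. a \<in># P} = {}"
      by (auto simp: partitions_of_def dest: multi_member_split)
    then show ?thesis using False by (simp only: card.empty if_False)
  qed
  ultimately show "fps_nth (gen_partitions A * (1 - fps_X ^ a)) n = fps_nth (gen_partitions (A - {a})) n"
    by (simp add: gen_partitions_nth right_diff_distrib fps_X_power_mult_right_nth)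
qed

lemma gen_partitions_remove_parts:
  assumes "finite B" "B \<subseteq> A" "0 \<notin> B"
  shows "gen_partitions A * (\<Prod>b\<in>B. 1 - fps_X ^ b) = gen_partitions (A - B)"
  using assms
proof (induction B rule: finite_induct)
  case (insert b B)
  then have "gen_partitions A * (\<Prod>b\<in>insert b B. 1 - fps_X ^ b) = gen_partitions (A - B) * (1 - fps_X ^ b)"
    by (simp add: mult_ac flip: insert.IH)
  also have "\<dots> = gen_partitions (A - B - {b})"
    using insert by (intro gen_partitions_remove_part) auto
  finally show ?case by (metis Diff_insert)
qed simp

lemma gen_partitions_remove_image:
  assumes "inj_on f I" "finite I" "f ` I \<subseteq> A" "\<And>i. i \<in> I \<Longrightarrow> f i > 0"
  shows "gen_partitions A * (\<Prod>i\<in>I. 1 - fps_X ^ f i) = gen_partitions (A - f ` I)"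
  using gen_partitions_remove_parts[of "f ` I" A] assms by (force simp: prod.reindex)

text \<open>Divisibility of a difference by \<open>X ^ K\<close> expresses agreement of the
  coefficients below \<open>K\<close>; such congruences stand in for limits.\<close>

lemma fps_X_power_dvd_iff: "(fps_X ^ K :: int fps) dvd f \<longleftrightarrow> (\<forall>i<K. fps_nth f i = 0)"
proof
  assume "\<forall>i<K. fps_nth f i = 0"
  then have "f = fps_X ^ K * fps_shift K f"
    by (intro fps_ext) (simp add: fps_X_power_mult_nth)
  then show "fps_X ^ K dvd f" by (rule dvdI)
qed (auto simp: fps_X_power_mult_nth elim!: dvdE)

lemma qpoch_X4_cong:
  assumes "M \<le> n" "K \<le> 4 * Suc M"
  shows "(fps_X ^ K :: int fps) dvd qpoch (fps_X ^ 4) n - qpoch (fps_X ^ 4) M"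
  using assms(1)
proof (induction n rule: dec_induct)
  case (step n)
  have "K \<le> 4 * Suc n" using step assms(2) by simp
  then have "(fps_X ^ K :: int fps) dvd (fps_X ^ 4) ^ Suc n"
    unfolding power_mult[symmetric] by (rule le_imp_power_dvd)
  then have "(fps_X ^ K :: int fps) dvd (qpoch (fps_X ^ 4) n - qpoch (fps_X ^ 4) M)
      - qpoch (fps_X ^ 4) n * (fps_X ^ 4) ^ Suc n"
    by (rule dvd_diff[OF step.IH dvd_mult])
  then show ?case by (simp add: qpoch_Suc algebra_simps del: power_Suc)
qed simp

text \<open>The witness counts partitions into multiples of 4. Multiplying by the first
  \<open>M\<close> factors leaves only parts of size at least \<open>K\<close>, so below degree
  \<open>K\<close> only the empty partition counts.\<close>

lemma qpoch_X4_inverse: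
  assumes "K \<le> 4 * Suc M"
  shows "\<exists>H :: int fps. fps_X ^ K dvd H * qpoch (fps_X ^ 4) M - 1"
proof
  let ?f = "\<lambda>i. 4 * Suc i"
  let ?A = "range ?f - ?f ` {..<M}"
  have H: "gen_partitions (range ?f) * qpoch (fps_X ^ 4) M = gen_partitions ?A"
    unfolding qpoch_def power_mult[symmetric]
    by (rule gen_partitions_remove_image) (auto simp: inj_on_def)
  have big: "4 * Suc M \<le> x" if "x \<in> ?A" for x
    using that by (auto simp: image_iff not_less)
  have "fps_nth (gen_partitions ?A) i = fps_nth (gen_partitions {}) i" if "i < K" for i
    using that big assms by (intro gen_partitions_nth_cong) fastforce
  moreover have "{P \<in> partitions_of i. set_mset P \<subseteq> {}} = (if i = 0 then {{#}} else {})" for i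
    by (auto simp: partitions_of_def)
  then have "gen_partitions {} = 1" by (intro fps_ext) (simp only: gen_partitions_nth, simp)
  ultimately show "fps_X ^ K dvd gen_partitions (range ?f) * qpoch (fps_X ^ 4) M - 1"
    unfolding H fps_X_power_dvd_iff by simp
qed

text \<open>As \<open>k\<close>, \<open>n - k\<close> and \<open>n\<close> are all at least
  \<open>M\<close>, the three factors in \<open>qbinom_mult_qpoch\<close> are congruent to
  \<open>E\<close>, whence \<open>B * E * E\<close> is congruent to \<open>E\<close>. The inverse
  \<open>H\<close> of \<open>E\<close> modulo \<open>X ^ K\<close> cancels one factor.\<close>

lemma qbinom_X4_mult_qpoch_cong_1:
  assumes "M \<le> k" "M + k \<le> n" "K \<le> 4 * Suc M"
  shows "(fps_X ^ K :: int fps) dvd qbinom (fps_X ^ 4) n k * qpoch (fps_X ^ 4) M - 1"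
proof -
  let ?p = "qpoch (fps_X ^ 4) :: nat \<Rightarrow> int fps"
  define B where "B = (qbinom (fps_X ^ 4) n k :: int fps)"
  define E where "E = ?p M"
  obtain H where H: "fps_X ^ K dvd H * E - 1" using qpoch_X4_inverse[OF assms(3)] E_def by blast
  have c: "fps_X ^ K dvd ?p l - E" if "M \<le> l" for l
    using qpoch_X4_cong[OF that assms(3)] by (simp add: E_def)
  have "B * ?p k * ?p (n - k) = ?p n"
    unfolding B_def by (rule qbinom_mult_qpoch) (use assms in simp)
  then have "B * E * E - E = (?p n - E) - B * (?p k * (?p (n - k) - E) + E * (?p k - E))"
    by (simp add: algebra_simps)
  also have "fps_X ^ K dvd \<dots>"
    by (rule dvd_diff[OF c dvd_mult[OF dvd_add[OF dvd_mult[OF c] dvd_mult[OF c]]]]) (use assms in auto)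
  finally have BEE: "fps_X ^ K dvd B * E * E - E" .
  have "B * E - 1 = H * (B * E * E - E) - B * E * (H * E - 1) + (H * E - 1)"
    by (simp add: algebra_simps)
  also have "fps_X ^ K dvd \<dots>" by (rule dvd_add[OF dvd_diff[OF dvd_mult[OF BEE] dvd_mult[OF H]] H])
  finally show ?thesis by (simp add: B_def E_def)
qed

text \<open>The finite triple product is multiplied by the partition series and by \<open>E\<close>.
  For central \<open>k\<close> the factor \<open>E\<close> neutralises the binomial coefficient up
  to degree \<open>m\<close>, and for the other \<open>k\<close> the theta exponent already exceeds
  \<open>m\<close>.\<close>

lemma gen_partitions_theta:
  assumes "m < N"
  shows "(\<Sum>k\<le>4 * N. (-1) ^ k * (if theta_exp (int k - int (2 * N)) \<le> m
      then int (num_partitions (m - theta_exp (int k - int (2 * N)))) else 0))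
    = int (card {P \<in> partitions_of m. \<forall>x\<in>#P. x mod 4 = 2})"
proof -
  define G where "G = gen_partitions {0<..}"
  define E where "E = (qpoch (fps_X ^ 4) N :: int fps)"
  define B where "B k = (qbinom (fps_X ^ 4) (4 * N) k :: int fps)" for k
  define e where "e k = theta_exp (int k - int (2 * N))" for k
  define T where "T k = (-1) ^ k * fps_X ^ e k * G" for k
  have jtp: "(\<Sum>k\<le>4 * N. (-1) ^ k * fps_X ^ e k * B k)
     = (\<Prod>i<2 * N. (1 - fps_X ^ (4 * i + 1)) * (1 - fps_X ^ (4 * i + 3) :: int fps))"
    using finite_jacobi_triple_product[of "fps_X :: int fps" "2 * N"] assms
    by (simp add: e_def B_def power_add power_mult)
  have "fps_X ^ Suc m dvd (-1) ^ k * fps_X ^ e k * B k * G * E - T k" if k: "k \<le> 4 * N" for k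
  proof (cases "N \<le> k \<and> N + k \<le> 4 * N")
    case True
    then have "fps_X ^ Suc m dvd B k * E - 1"
      unfolding B_def E_def using assms by (intro qbinom_X4_mult_qpoch_cong_1) auto
    then have "fps_X ^ Suc m dvd (-1) ^ k * fps_X ^ e k * G * (B k * E - 1)" by (rule dvd_mult)
    then show ?thesis by (simp add: T_def algebra_simps)
  next
    case False
    define j where "j = int k - int (2 * N)"
    \<comment> \<open>Outside the central range the distance of \<open>k\<close> from
      \<open>2 * N\<close> exceeds \<open>N\<close>, hence \<open>m\<close>.\<close>
    have j: "\<bar>j\<bar> > int m" using False k assms by (auto simp: j_def)
    have "\<bar>j\<bar> \<le> j * (2 * j - 1)"
    proof (cases "j \<ge> 1")
      case True
      then have "j * 1 \<le> j * (2 * j - 1)" by (intro mult_left_mono) auto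
      then show ?thesis using True by simp
    next
      case False
      then have "(- j) * 1 \<le> (- j) * (1 - 2 * j)" by (intro mult_left_mono) auto
      then show ?thesis using False by (simp add: algebra_simps)
    qed
    then have "Suc m \<le> e k" using j int_theta_exp[of j] by (simp add: e_def j_def)
    then have "(fps_X ^ Suc m :: int fps) dvd fps_X ^ e k" by (rule le_imp_power_dvd)
    then have "fps_X ^ Suc m dvd fps_X ^ e k * ((-1) ^ k * B k * G * E - (-1) ^ k * G)"
      by (rule dvd_mult2)
    then show ?thesis by (simp add: T_def algebra_simps)
  qed
  then have "fps_X ^ Suc m dvd (\<Sum>k\<le>4 * N. (-1) ^ k * fps_X ^ e k * B k * G * E - T k)"
    by (intro dvd_sum) auto
  then have "fps_X ^ Suc m dvd (\<Sum>k\<le>4 * N. (-1) ^ k * fps_X ^ e k * B k) * G * E - (\<Sum>k\<le>4 * N. T k)"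
    by (simp add: sum_subtractf sum_distrib_right)
  then have "fps_nth (\<Sum>k\<le>4 * N. T k) m = fps_nth ((\<Sum>k\<le>4 * N. (-1) ^ k * fps_X ^ e k * B k) * G * E) m"
    unfolding fps_X_power_dvd_iff by simp
  \<comment> \<open>On the product side the factors successively delete the small parts congruent to
    1, 3 and 0 modulo 4.\<close>
  also have "(\<Sum>k\<le>4 * N. (-1) ^ k * fps_X ^ e k * B k) * G * E
      = gen_partitions {0<..} * (\<Prod>i<2 * N. 1 - fps_X ^ (4 * i + 1)) * (\<Prod>i<2 * N. 1 - fps_X ^ (4 * i + 3)) * E"
    unfolding jtp prod.distrib G_def by (simp add: mult_ac)
  also have "gen_partitions {0<..} * (\<Prod>i<2 * N. 1 - fps_X ^ (4 * i + 1))
      = gen_partitions ({0<..} - (\<lambda>i. 4 * i + 1) ` {..<2 * N})"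
    by (rule gen_partitions_remove_image) (auto simp: inj_on_def)
  also have "\<dots> * (\<Prod>i<2 * N. 1 - fps_X ^ (4 * i + 3))
      = gen_partitions ({0<..} - (\<lambda>i. 4 * i + 1) ` {..<2 * N} - (\<lambda>i. 4 * i + 3) ` {..<2 * N})"
    by (rule gen_partitions_remove_image) (auto simp: inj_on_def, presburger)
  also have "\<dots> * E = gen_partitions ({0<..} - (\<lambda>i. 4 * i + 1) ` {..<2 * N} - (\<lambda>i. 4 * i + 3) ` {..<2 * N}
      - (\<lambda>i. 4 * Suc i) ` {..<N})"
    unfolding E_def qpoch_def power_mult[symmetric]
    by (rule gen_partitions_remove_image) (auto simp: inj_on_def, presburger+)
  \<comment> \<open>Only parts up to \<open>m < N\<close> matter for this coefficient, and in that
    range each of the three classes has been deleted completely.\<close>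
  also have "fps_nth \<dots> m = fps_nth (gen_partitions {x. x mod 4 = 2}) m"
  proof (rule gen_partitions_nth_cong)
    fix x assume x: "0 < x" "x \<le> m"
    have 1: "x mod 4 = 1 \<longleftrightarrow> x \<in> (\<lambda>i. 4 * i + 1) ` {..<2 * N}"
    proof
      assume "x mod 4 = 1"
      then have "x = 4 * (x div 4) + 1" by presburger
      then show "x \<in> (\<lambda>i. 4 * i + 1) ` {..<2 * N}" by (rule image_eqI) (use x assms in auto)
    qed auto
    have 3: "x mod 4 = 3 \<longleftrightarrow> x \<in> (\<lambda>i. 4 * i + 3) ` {..<2 * N}"
    proof
      assume "x mod 4 = 3"
      then have "x = 4 * (x div 4) + 3" by presburger
      then show "x \<in> (\<lambda>i. 4 * i + 3) ` {..<2 * N}" by (rule image_eqI) (use x assms in auto)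
    qed auto
    have 0: "x mod 4 = 0 \<longleftrightarrow> x \<in> (\<lambda>i. 4 * Suc i) ` {..<N}"
    proof
      assume "x mod 4 = 0"
      then have "x = 4 * Suc (x div 4 - 1)" using x by presburger
      then show "x \<in> (\<lambda>i. 4 * Suc i) ` {..<N}" by (rule image_eqI) (use x assms in auto)
    qed auto
    have "x mod 4 = 2 \<longleftrightarrow> x mod 4 \<noteq> 0 \<and> x mod 4 \<noteq> 1 \<and> x mod 4 \<noteq> 3" by presburger
    then show "x \<in> {0<..} - (\<lambda>i. 4 * i + 1) ` {..<2 * N} - (\<lambda>i. 4 * i + 3) ` {..<2 * N}
      - (\<lambda>i. 4 * Suc i) ` {..<N} \<longleftrightarrow> x \<in> {x. x mod 4 = 2}"
      unfolding 0 1 3 using x by blast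
  qed
  also have "\<dots> = int (card {P \<in> partitions_of m. \<forall>x\<in>#P. x mod 4 = 2})"
    by (simp add: gen_partitions_nth subset_eq)
  also have "fps_nth (\<Sum>k\<le>4 * N. T k) m
      = (\<Sum>k\<le>4 * N. (-1) ^ k * (if e k \<le> m then int (num_partitions (m - e k)) else 0))"
  proof -
    have "{P \<in> partitions_of n. set_mset P \<subseteq> {0<..}} = partitions_of n" for n
      by (auto simp: partitions_of_def)
    then have G: "fps_nth G n = int (num_partitions n)" for n
      by (simp add: G_def gen_partitions_nth num_partitions_def)
    have "fps_nth (T k) m = (-1) ^ k * (if e k \<le> m then int (num_partitions (m - e k)) else 0)" for k
    proof -
      have "T k = fps_const ((-1) ^ k) * (fps_X ^ e k * G)"
        by (simp add: T_def mult.assoc flip: fps_const_power fps_const_neg)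
      then show ?thesis by (simp add: fps_X_power_mult_nth G)
    qed
    then show ?thesis by (simp add: fps_sum_nth)
  qed
  finally show ?thesis by (simp only: e_def)
qed

text \<open>Halving every part is a bijection onto partitions into odd parts.\<close>

lemma card_partitions_2_mod_4:
  "card {P \<in> partitions_of m. \<forall>x\<in>#P. x mod 4 = 2}
    = (if even m then num_odd_partitions (m div 2) else 0)"
proof -
  have sum2: "sum_mset (image_mset ((*) 2) P) = 2 * sum_mset P" for P :: "nat multiset"
    by (induction P) auto
  have "{P \<in> partitions_of m. \<forall>x\<in>#P. x mod 4 = 2}
      = image_mset ((*) 2) ` {P. (\<forall>x\<in>#P. odd x) \<and> 2 * sum_mset P = m}"
  proof (intro equalityI subsetI)
    fix P assume P: "P \<in> {P \<in> partitions_of m. \<forall>x\<in>#P. x mod 4 = 2}"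
    define R where "R = image_mset (\<lambda>x. x div 2) P"
    have h: "odd (x div 2) \<and> 2 * (x div 2) = x" if "x \<in># P" for x
    proof -
      have "x mod 4 = 2" using P that by simp
      then show ?thesis by presburger
    qed
    have "image_mset ((*) 2) R = image_mset id P"
      unfolding R_def multiset.map_comp by (rule image_mset_cong) (use h in simp)
    then have PR: "P = image_mset ((*) 2) R" by simp
    moreover have "\<forall>x\<in>#R. odd x" using h by (auto simp: R_def)
    moreover have "2 * sum_mset R = m" using P PR sum2[of R] by (auto simp: partitions_of_def)
    ultimately show "P \<in> image_mset ((*) 2) ` {P. (\<forall>x\<in>#P. odd x) \<and> 2 * sum_mset P = m}" by blast
  next
    fix P assume "P \<in> image_mset ((*) 2) ` {P. (\<forall>x\<in>#P. odd x) \<and> 2 * sum_mset P = m}"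
    then obtain R where R: "P = image_mset ((*) 2) R" "\<forall>x\<in>#R. odd x" "2 * sum_mset R = m" by blast
    have "0 < 2 * x \<and> 2 * x mod 4 = 2" if "odd x" for x :: nat using that by presburger
    then show "P \<in> {P \<in> partitions_of m. \<forall>x\<in>#P. x mod 4 = 2}"
      using R sum2 by (auto simp: partitions_of_def)
  qed
  moreover have "inj_on (image_mset ((*) (2::nat))) R" for R
    by (rule inj_on_subset[OF multiset.inj_map]) (simp_all add: inj_def)
  ultimately have "card {P \<in> partitions_of m. \<forall>x\<in>#P. x mod 4 = 2}
      = card {P. (\<forall>x\<in>#P. odd x) \<and> 2 * sum_mset P = m}"
    by (simp only: card_image)
  also have "{P. (\<forall>x\<in>#P. odd x) \<and> 2 * sum_mset P = m}
      = (if even m then {P \<in> partitions_of (m div 2). \<forall>x\<in>#P. odd x} else {})"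
  proof -
    have "2 * s = m \<longleftrightarrow> even m \<and> s = m div 2" for s :: nat by presburger
    then have "{P. (\<forall>x\<in>#P. odd x) \<and> 2 * sum_mset P = m}
        = {P. (\<forall>x\<in>#P. odd x) \<and> even m \<and> sum_mset P = m div 2}" by (simp only:)
    moreover have "(\<forall>x\<in>#P. 0 < x) \<and> (\<forall>x\<in>#P. odd x) \<longleftrightarrow> (\<forall>x\<in>#P. odd x)" for P :: "nat multiset"
      using odd_pos by blast
    ultimately show ?thesis by (cases "even m") (simp_all add: partitions_of_def, metis)
  qed
  finally show ?thesis by (simp add: num_odd_partitions_def)
qed

section \<open>Assembling the truncated identity\<close>

lemma sum_stair_3: "(\<Sum>j<N. 3 + 4 * j) = N * (2 * N + 1)" for N :: nat
  by (induction N) (auto simp: algebra_simps)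

lemma sum_stair_1: "(\<Sum>j<Suc N. Suc (4 * j)) = (N + 1) * (2 * N + 1)" for N :: nat
  by (induction N) (auto simp: algebra_simps)

text \<open>The half \<open>k \<le> 2 * N\<close> of the theta sum telescopes through the class of
  3, the other half through the class of 1. The latter starts at \<open>\<tau> = 1\<close>, as the
  term of the empty staircase belongs to the first half.\<close>

lemma card_durfee_diff:
  "int (card (durfee_partitions 3 4 0 m)) - int (card (durfee_partitions 1 4 1 m))
    = (if even m then int (num_odd_partitions (m div 2)) else 0)"
proof -
  define N where "N = Suc m"
  define f where "f e = (if e \<le> m then int (num_partitions (m - e)) else 0)" for e
  let ?g = "\<lambda>k. (-1) ^ k * f (theta_exp (int k - int (2 * N)))"
  have st3: "int (card (staircase_partitions 3 4 \<tau> m)) = f (\<tau> * (2 * \<tau> + 1))" for \<tau>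
    by (simp add: card_staircase_partitions sum_stair_3 f_def)
  have st1: "int (card (staircase_partitions 1 4 (Suc \<tau>) m)) = f ((\<tau> + 1) * (2 * \<tau> + 1))" for \<tau>
    by (simp add: card_staircase_partitions sum_stair_1 f_def del: sum.lessThan_Suc)
  have "?g (2 * N - \<tau>) = (-1) ^ \<tau> * int (card (staircase_partitions 3 4 \<tau> m))" if "\<tau> \<le> 2 * N" for \<tau>
  proof -
    have "int (theta_exp (int (2 * N - \<tau>) - int (2 * N))) = int (\<tau> * (2 * \<tau> + 1))"
      unfolding int_theta_exp using that by (simp add: of_nat_diff algebra_simps)
    then have "theta_exp (int (2 * N - \<tau>) - int (2 * N)) = \<tau> * (2 * \<tau> + 1)"
      by (simp only: of_nat_eq_iff)
    moreover have "(-1) ^ (2 * N - \<tau>) = ((-1) ^ \<tau> :: int)"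
      using that by (simp add: minus_one_power_iff)
    ultimately show ?thesis by (simp only: st3)
  qed
  then have "(\<Sum>\<tau>\<le>2 * N. ?g (2 * N - \<tau>)) = (\<Sum>\<tau>=0..<0 + Suc (2 * N). (-1) ^ \<tau> * int (card (staircase_partitions 3 4 \<tau> m)))"
    by (intro sum.cong) auto
  also have "\<dots> = int (card (durfee_partitions 3 4 0 m)) - (-1) ^ (Suc (2 * N)) * int (card (durfee_partitions 3 4 (Suc (2 * N)) m))"
    by (subst alternating_staircase_sum) auto
  \<comment> \<open>A staircase of this length already sums to more than \<open>m\<close>, so the
    boundary term vanishes.\<close>
  also have "card (durfee_partitions 3 4 (Suc (2 * N)) m) = 0"
  proof -
    have "int (card (staircase_partitions 3 4 (Suc (2 * N)) m)) = 0"
      unfolding st3 by (simp add: f_def N_def)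
    then show ?thesis using card_durfee_rec[of 4 3 "Suc (2 * N)" m] by simp
  qed
  finally have s3: "(\<Sum>\<tau>\<le>2 * N. ?g (2 * N - \<tau>)) = int (card (durfee_partitions 3 4 0 m))" by simp
  have "?g (2 * N + \<tau>) = (-1) ^ \<tau> * int (card (staircase_partitions 1 4 \<tau> m))" if "1 \<le> \<tau>" for \<tau>
  proof -
    obtain \<sigma> where \<sigma>: "\<tau> = Suc \<sigma>" using \<open>1 \<le> \<tau>\<close> by (cases \<tau>) auto
    have "int (theta_exp (int (2 * N + \<tau>) - int (2 * N))) = int ((\<sigma> + 1) * (2 * \<sigma> + 1))"
      unfolding int_theta_exp by (simp add: \<sigma> algebra_simps)
    then have "theta_exp (int (2 * N + \<tau>) - int (2 * N)) = (\<sigma> + 1) * (2 * \<sigma> + 1)"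
      by (simp only: of_nat_eq_iff)
    moreover have "(-1) ^ (2 * N + \<tau>) = ((-1) ^ \<tau> :: int)" by (simp add: power_add power_mult)
    ultimately show ?thesis unfolding \<sigma> by (simp only: st1)
  qed
  then have "(\<Sum>\<tau>=1..<1 + 2 * N. ?g (2 * N + \<tau>)) = (\<Sum>\<tau>=1..<1 + 2 * N. (-1) ^ \<tau> * int (card (staircase_partitions 1 4 \<tau> m)))"
    by (intro sum.cong) auto
  also have "\<dots> = - int (card (durfee_partitions 1 4 1 m)) - (-1) ^ (1 + 2 * N) * int (card (durfee_partitions 1 4 (1 + 2 * N) m))"
    by (subst alternating_staircase_sum) auto
  also have "card (durfee_partitions 1 4 (1 + 2 * N) m) = 0"
  proof -
    have "int (card (staircase_partitions 1 4 (Suc (2 * N)) m)) = 0"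
      unfolding st1 by (simp add: f_def N_def)
    then show ?thesis using card_durfee_rec[of 4 1 "Suc (2 * N)" m] by simp
  qed
  finally have s1: "(\<Sum>\<tau>=1..<1 + 2 * N. ?g (2 * N + \<tau>)) = - int (card (durfee_partitions 1 4 1 m))" by simp
  have split: "(\<Sum>k\<le>n + l. g k) = (\<Sum>\<tau>\<le>n. g (n - \<tau>)) + (\<Sum>\<tau>=1..<1 + l. g (n + \<tau>))"
    for g :: "nat \<Rightarrow> int" and n l
  proof (induction l)
    case 0
    show ?case using sum.nat_diff_reindex[of g "Suc n"] by (simp add: lessThan_Suc_atMost)
  qed simp
  have "(\<Sum>k\<le>4 * N. ?g k) = int (card (durfee_partitions 3 4 0 m)) - int (card (durfee_partitions 1 4 1 m))"
    using split[of ?g "2 * N" "2 * N"] unfolding s1 s3 by simp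
  moreover have "m < N" by (simp add: N_def)
  from gen_partitions_theta[OF this]
  have "(\<Sum>k\<le>4 * N. ?g k) = int (card {P \<in> partitions_of m. \<forall>x\<in>#P. x mod 4 = 2})"
    unfolding f_def .
  ultimately show ?thesis by (simp add: card_partitions_2_mod_4)
qed

lemma truncated_theta_partitions:
  assumes "\<nu> \<ge> 1" "\<nu> * (2 * \<nu> + 1) \<le> m"
  shows "(-1) ^ \<nu> *
      ((\<Sum>\<tau>=0..\<nu>. (-1) ^ \<tau> * int (num_partitions (m - \<tau> * (2 * \<tau> + 1))))
       - (\<Sum>\<tau>=0..\<nu> - 1. (-1) ^ \<tau> * int (num_partitions (m - (\<tau> + 1) * (2 * \<tau> + 1)))))
    = (-1) ^ \<nu> * (if even m then int (num_odd_partitions (m div 2)) else 0)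
      + int (p_amnu 3 4 \<nu> m) + int (p_amnu 1 4 \<nu> m)"
proof -
  \<comment> \<open>These bounds matter because truncated subtraction would yield
    \<open>num_partitions 0 = 1\<close> where the staircase count is \<open>0\<close>.\<close>
  have le3: "\<tau> * (2 * \<tau> + 1) \<le> m" if "\<tau> \<le> \<nu>" for \<tau>
    using mult_le_mono[of \<tau> \<nu> "2 * \<tau> + 1" "2 * \<nu> + 1"] that assms(2) by simp
  have le1: "(\<tau> + 1) * (2 * \<tau> + 1) \<le> m" if "\<tau> < \<nu>" for \<tau>
    using mult_le_mono[of "\<tau> + 1" \<nu> "2 * \<tau> + 1" "2 * \<nu> + 1"] that assms(2) by simp
  have "(\<Sum>\<tau>=0..\<nu>. (-1) ^ \<tau> * int (num_partitions (m - \<tau> * (2 * \<tau> + 1))))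
      = (\<Sum>\<tau>=0..<0 + Suc \<nu>. (-1) ^ \<tau> * int (card (staircase_partitions 3 4 \<tau> m)))"
    using le3 by (intro sum.cong) (auto simp: card_staircase_partitions sum_stair_3)
  also have "\<dots> = int (card (durfee_partitions 3 4 0 m)) + (-1) ^ \<nu> * int (p_amnu 3 4 \<nu> m)"
    by (subst alternating_staircase_sum) (auto simp: p_amnu_eq_card_durfee)
  finally have s3: "(\<Sum>\<tau>=0..\<nu>. (-1) ^ \<tau> * int (num_partitions (m - \<tau> * (2 * \<tau> + 1)))) = \<dots>" .
  have "(\<Sum>\<tau>=0..\<nu> - 1. (-1) ^ \<tau> * int (num_partitions (m - (\<tau> + 1) * (2 * \<tau> + 1))))
      = - (\<Sum>\<tau>=0..<\<nu>. (-1) ^ Suc \<tau> * int (card (staircase_partitions 1 4 (Suc \<tau>) m)))"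
    unfolding sum_negf[symmetric] using le1 assms(1)
    by (intro sum.cong)
      (auto simp: card_staircase_partitions sum_stair_1 simp del: sum.lessThan_Suc)
  also have "\<dots> = - (\<Sum>\<tau>=1..<1 + \<nu>. (-1) ^ \<tau> * int (card (staircase_partitions 1 4 \<tau> m)))"
    using sum.shift_bounds_Suc_ivl[of "\<lambda>\<tau>. (-1) ^ \<tau> * int (card (staircase_partitions 1 4 \<tau> m))" 0 \<nu>] by simp
  also have "\<dots> = int (card (durfee_partitions 1 4 1 m)) - (-1) ^ \<nu> * int (p_amnu 1 4 \<nu> m)"
    by (subst alternating_staircase_sum) (auto simp: p_amnu_eq_card_durfee)
  finally have s1: "(\<Sum>\<tau>=0..\<nu> - 1. (-1) ^ \<tau> * int (num_partitions (m - (\<tau> + 1) * (2 * \<tau> + 1)))) = \<dots>" .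
  have sq: "(-1) ^ \<nu> * ((-1) ^ \<nu> * x) = (x :: int)" for x
    by (simp add: minus_one_power_iff)
  show ?thesis
    unfolding s3 s1 card_durfee_diff[symmetric] by (simp add: algebra_simps sq)
qed

theorem theorem1p4:
  fixes \<nu> n :: nat
  assumes "\<nu> \<ge> 1" and "n > \<nu> * (2 * \<nu> + 3)"
  shows "((-1) ^ \<nu> *
      ((\<Sum>\<tau>=0..\<nu>. (-1) ^ \<tau> * int (num_partitions (2 * n - \<tau> * (2 * \<tau> + 1))))
       - (\<Sum>\<tau>=0..\<nu> - 1. (-1) ^ \<tau> * int (num_partitions (2 * n - (\<tau> + 1) * (2 * \<tau> + 1)))))
    = (-1) ^ \<nu> * int (num_odd_partitions n)
      + int (p_amnu 3 4 \<nu> (2 * n)) + int (p_amnu 1 4 \<nu> (2 * n)))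
  \<and> ((-1) ^ \<nu> *
      ((\<Sum>\<tau>=0..\<nu>. (-1) ^ \<tau> * int (num_partitions (2 * n + 1 - \<tau> * (2 * \<tau> + 1))))
       - (\<Sum>\<tau>=0..\<nu> - 1. (-1) ^ \<tau> * int (num_partitions (2 * n + 1 - (\<tau> + 1) * (2 * \<tau> + 1)))))
    = int (p_amnu 3 4 \<nu> (2 * n + 1)) + int (p_amnu 1 4 \<nu> (2 * n + 1)))"
proof -
  have "\<nu> * (2 * \<nu> + 1) \<le> \<nu> * (2 * \<nu> + 3)" by (rule mult_le_mono2) simp
  then have "\<nu> * (2 * \<nu> + 1) \<le> 2 * n" "\<nu> * (2 * \<nu> + 1) \<le> 2 * n + 1" using assms(2) by linarith+
  from this[THEN truncated_theta_partitions[OF assms(1)]] show ?thesis by simp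
qed

end
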